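(* Let $G_{k}=(V,E)$ be either a square grid ($k=4$), or a triangular grid ($k=6$), or a hexagonal grid ($k=3$), and let $\widetilde\Gamma:V \to \widetilde C$ be a periodic coloring of $G_{k}$ with a finite color set $\widetilde C$. Then there exists a perfect coloring $\Gamma: V \to C$ of $G_k$ with a finite color set $C$ such that, for each pair of vertices $i,j \in V$, $\widetilde\Gamma(i) \neq \widetilde\Gamma(j)$ implies $\Gamma(i) \neq \Gamma(j)$.
   Context: The square/triangular/hexagonal grid is the graph of vertices and edges of the regular tessellation of $\mathbb{R}^2$ by squares/equilateral triangles/regular hexagons. In each case the vertices are placed at the points of $V=\mathbb{Z}^2$: in the square grid $x$ is adjacent to $x\pm(1,0)$, $x\pm(0,1)$; in the triangular grid $x$ is adjacent to $x\pm(1,0)$, $x\pm(0,1)$, $x\pm(1,-1)$; in the hexagonal grid (brick-wall layout) $(x,y)$ is adjacent to $(x\pm1,y)$ and to $(x,y+1)$ if $x+y$ is even, to $(x,y-1)$ if $x+y$ is odd. A coloring is a map from $V$ to a finite set of colors. A coloring $\Gamma$ is periodic if there exist two linearly independent vectors $v_1,v_2\in\mathbb{Z}^2$ such that $\Gamma(i)=\Gamma(i+v_1)=\Gamma(i+v_2)$ for all $i\in V$; for the hexagonal grid it is additionally required that all coordinates of $v_1$ and $v_2$ are even. A coloring $\Gamma:V\to C=\{1,\dots,n\}$ of a $k$-regular graph is perfect if it is $\mathbf{m}$-perfect for some matrix $\mathbf{m}\in\mathbb{N}_0^{n\times n}$ with all row sums equal to $k$, i.e. for every $i\in V$ and every $c\in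 C$ the number of neighbors $j$ of $i$ with $\Gamma(j)=c$ equals $m_{\Gamma(i)c}$. *)

theory Defs
  imports Complex_Main "HOL-Analysis.Product_Vector" "HOL-Library.FuncSet"
begin

type_synonym vertex = "int \<times> int"

datatype grid = Square | Triangular | Hexagonal

fun grid_adj :: "grid \<Rightarrow> vertex \<Rightarrow> vertex \<Rightarrow> bool" where
  "grid_adj Square u v \<longleftrightarrow>
     v \<in> {u + (1, 0), u - (1, 0), u + (0, 1), u - (0, 1)}"
| "grid_adj Triangular u v \<longleftrightarrow>
     v \<in> {u + (1, 0), u - (1, 0), u + (0, 1), u - (0, 1), u + (1, -1), u - (1, -1)}"
| "grid_adj Hexagonal (x, y) v \<longleftrightarrow>
     v \<in> {(x + 1, y), (x - 1, y), if even (x + y) then (x, y + 1) else (x, y - 1)}"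

fun grid_degree :: "grid \<Rightarrow> nat" where
  "grid_degree Square = 4"
| "grid_degree Triangular = 6"
| "grid_degree Hexagonal = 3"

definition neighbors :: "('v \<Rightarrow> 'v \<Rightarrow> bool) \<Rightarrow> 'v \<Rightarrow> 'v set" where
  "neighbors adj i = {j. adj i j}"

definition regular_graph :: "('v \<Rightarrow> 'v \<Rightarrow> bool) \<Rightarrow> nat \<Rightarrow> bool" where
  "regular_graph adj k \<longleftrightarrow> symp adj \<and> irreflp adj \<and>
     (\<forall>i. finite (neighbors adj i) \<and> card (neighbors adj i) = k)"

lemma grid_regular: "regular_graph (grid_adj G) (grid_degree G)"
proof -
  have nb: "neighbors (grid_adj Square) u =
       {u + (1, 0), u - (1, 0), u + (0, 1), u - (0, 1)}"
     "neighbors (grid_adj Triangular) u =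
       {u + (1, 0), u - (1, 0), u + (0, 1), u - (0, 1), u + (1, -1), u - (1, -1)}"
     "neighbors (grid_adj Hexagonal) (x, y) =
       {(x + 1, y), (x - 1, y), if even (x + y) then (x, y + 1) else (x, y - 1)}"
    for u x y
    by (auto simp: neighbors_def)
  show ?thesis
    unfolding regular_graph_def
  proof (intro conjI allI)
    show "symp (grid_adj G)"
      by (cases G) (auto intro!: sympI split: if_splits)
    show "irreflp (grid_adj G)"
      by (cases G) (auto intro!: irreflpI split: if_splits)
    fix i
    show "finite (neighbors (grid_adj G) i)"
      by (cases G; cases i) (auto simp: nb)
    show "card (neighbors (grid_adj G) i) = grid_degree G"
      by (cases G; cases i) (auto simp: nb)
  qed
qed

definition real_vec :: "int \<times> int \<Rightarrow> real \<times> real" where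
  "real_vec v = (of_int (fst v), of_int (snd v))"

text \<open>The condition \<open>v1 \<noteq> v2\<close> is needed since \<^const>\<open>independent\<close> speaks about sets,
  and \<open>{v, v}\<close> is independent for nonzero \<open>v\<close>.\<close>

definition lin_indep_pair :: "int \<times> int \<Rightarrow> int \<times> int \<Rightarrow> bool" where
  "lin_indep_pair v1 v2 \<longleftrightarrow> v1 \<noteq> v2 \<and> independent {real_vec v1, real_vec v2}"

definition even_vec :: "int \<times> int \<Rightarrow> bool" where
  "even_vec v \<longleftrightarrow> even (fst v) \<and> even (snd v)"

definition periodic_coloring :: "grid \<Rightarrow> (vertex \<Rightarrow> 'c) \<Rightarrow> bool" where
  "periodic_coloring G \<Gamma> \<longleftrightarrow>
     (\<exists>v1 v2. lin_indep_pair v1 v2 \<and>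
        (\<forall>i. \<Gamma> i = \<Gamma> (i + v1) \<and> \<Gamma> i = \<Gamma> (i + v2)) \<and>
        (G = Hexagonal \<longrightarrow> even_vec v1 \<and> even_vec v2))"

text \<open>Only the entries \<open>m a c\<close> with \<open>a, c \<in> {1..n}\<close> of the matrix \<open>m\<close> are relevant. The
  vertex set is the whole type \<open>'v\<close>, and \<open>adj\<close> is meant to be \<open>k\<close>-regular.\<close>

definition m_perfect_coloring ::
  "('v \<Rightarrow> 'v \<Rightarrow> bool) \<Rightarrow> nat \<Rightarrow> nat \<Rightarrow> (nat \<Rightarrow> nat \<Rightarrow> nat) \<Rightarrow> ('v \<Rightarrow> nat) \<Rightarrow> bool" where
  "m_perfect_coloring adj k n m \<Gamma> \<longleftrightarrow>
     \<Gamma> \<in> UNIV \<rightarrow> {1..n} \<and>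
     (\<forall>a\<in>{1..n}. (\<Sum>c\<in>{1..n}. m a c) = k) \<and>
     (\<forall>i. \<forall>c\<in>{1..n}. card {j \<in> neighbors adj i. \<Gamma> j = c} = m (\<Gamma> i) c)"

definition perfect_coloring ::
  "('v \<Rightarrow> 'v \<Rightarrow> bool) \<Rightarrow> nat \<Rightarrow> nat \<Rightarrow> ('v \<Rightarrow> nat) \<Rightarrow> bool" where
  "perfect_coloring adj k n \<Gamma> \<longleftrightarrow> (\<exists>m. m_perfect_coloring adj k n m \<Gamma>)"

end

theory Submission
  imports Defs
begin

text \<open>The perfect coloring is the coloring by orbits of a translation lattice. From the two
  independent periods \<open>v1\<close>, \<open>v2\<close> with determinant \<open>D \<noteq> 0\<close>, Cramer's rule gives the periods
  \<open>(D, 0)\<close> and \<open>(0, D)\<close>, so that the given coloring factors through reduction of both coordinates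
  modulo \<open>N = 2 * \<bar>D\<bar>\<close> (lemmas \<open>periodic_axis_period\<close> and \<open>period_imp_eq_mod\<close>).
  This reduction is a coloring with finitely many colors which refines the given one. Since \<open>N\<close>
  is even, translations by vectors of \<open>N\<int> \<times> N\<int>\<close> are automorphisms of each grid
  (lemma \<open>grid_adj_translate\<close>), also of the hexagonal one, where the parity of \<open>x + y\<close> has to be
  kept; they preserve the new coloring and act transitively on each of its color classes. Hence all
  vertices of one class see the same colors around them, so that the coloring is perfect
  (lemma \<open>transitive_classes_imp_perfect\<close>).\<close>

text \<open>An automorphism that moves \<open>i\<close> to \<open>j\<close> and preserves colors matches the neighbors of \<open>i\<close>
  of each color with those of \<open>j\<close>, so the matrix can be read off at any representative of a class.
  The colors are renumbered bijectively: every number in \<open>{1..n}\<close> then occurs, and every row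
  of the matrix is the row of an actual vertex, with sum \<open>k\<close>.\<close>

lemma transitive_classes_imp_perfect:
  fixes adj :: "'v \<Rightarrow> 'v \<Rightarrow> bool" and f :: "'v \<Rightarrow> 'a"
  assumes reg: "regular_graph adj k"
    and fin: "finite (range f)"
    and trans: "\<And>i j. f i = f j \<Longrightarrow>
      \<exists>T. bij T \<and> (\<forall>u v. adj (T u) (T v) \<longleftrightarrow> adj u v) \<and> (\<forall>u. f (T u) = f u) \<and> T i = j"
  shows "\<exists>n \<Gamma>. perfect_coloring adj k n \<Gamma> \<and> (\<forall>i j. f i \<noteq> f j \<longrightarrow> \<Gamma> i \<noteq> \<Gamma> j)"
proof -
  define n where "n = card (range f)"
  obtain h where h: "bij_betw h (range f) {1..n}"
    using finite_same_card_bij[OF fin, of "{1..n}"] unfolding n_def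
    by (metis card_atLeastAtMost diff_Suc_1 finite_atLeastAtMost One_nat_def)
  define \<Gamma> where "\<Gamma> = h \<circ> f"
  have \<Gamma>_eq: "\<Gamma> i = \<Gamma> j \<longleftrightarrow> f i = f j" for i j
    using h by (auto simp: \<Gamma>_def bij_betw_def inj_on_def)
  have range_\<Gamma>: "range \<Gamma> = {1..n}"
    using h by (simp add: \<Gamma>_def bij_betw_def image_comp)
  define r where "r c = (SOME i. \<Gamma> i = c)" for c
  have r: "\<Gamma> (r c) = c" if "c \<in> {1..n}" for c
    unfolding r_def using that range_\<Gamma> by (metis (mono_tags, lifting) imageE someI)
  define m where "m a c = card {j \<in> neighbors adj (r a). \<Gamma> j = c}" for a c
  have same_counts: "card {u \<in> neighbors adj i. \<Gamma> u = c} = card {u \<in> neighbors adj j. \<Gamma> u = c}"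
    if "\<Gamma> i = \<Gamma> j" for i j c
  proof -
    obtain T where T: "bij T" "\<And>u v. adj (T u) (T v) \<longleftrightarrow> adj u v" "\<And>u. f (T u) = f u" "T i = j"
      using trans[of i j] \<open>\<Gamma> i = \<Gamma> j\<close> \<Gamma>_eq by blast
    have "bij_betw T {u \<in> neighbors adj i. \<Gamma> u = c} {u \<in> neighbors adj j. \<Gamma> u = c}"
    proof (rule bij_betw_imageI)
      show "inj_on T {u \<in> neighbors adj i. \<Gamma> u = c}"
        using T(1) by (auto simp: bij_def inj_on_def)
      show "T ` {u \<in> neighbors adj i. \<Gamma> u = c} = {u \<in> neighbors adj j. \<Gamma> u = c}"
      proof (intro equalityI subsetI)
        fix v assume "v \<in> {u \<in> neighbors adj j. \<Gamma> u = c}"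
        moreover obtain u where "v = T u"
          using T(1) by (metis bij_pointE)
        ultimately show "v \<in> T ` {u \<in> neighbors adj i. \<Gamma> u = c}"
          using T(2,3) T(4)[symmetric] by (auto simp: neighbors_def \<Gamma>_def)
      qed (use T(2,3) T(4)[symmetric] in \<open>auto simp: neighbors_def \<Gamma>_def\<close>)
    qed
    then show ?thesis
      by (rule bij_betw_same_card)
  qed
  have row_sum: "(\<Sum>c\<in>{1..n}. m a c) = k" for a
  proof -
    let ?N = "neighbors adj (r a)"
    have "finite ?N" "card ?N = k"
      using reg by (auto simp: regular_graph_def)
    moreover have "(\<Sum>c\<in>{1..n}. \<Sum>j\<in>{j \<in> ?N. \<Gamma> j = c}. 1) = (\<Sum>j\<in>?N. 1::nat)"
      using range_\<Gamma> \<open>finite ?N\<close> by (intro sum.group) auto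
    ultimately show ?thesis
      by (simp add: m_def)
  qed
  have "m_perfect_coloring adj k n m \<Gamma>"
    unfolding m_perfect_coloring_def
  proof (intro conjI ballI allI)
    show "\<Gamma> \<in> UNIV \<rightarrow> {1..n}"
      using range_\<Gamma> by auto
  next
    fix i c
    have "\<Gamma> (r (\<Gamma> i)) = \<Gamma> i"
      using r range_\<Gamma> by blast
    then show "card {j \<in> neighbors adj i. \<Gamma> j = c} = m (\<Gamma> i) c"
      unfolding m_def by (intro same_counts) simp
  qed (rule row_sum)
  then show ?thesis
    using \<Gamma>_eq by (auto simp: perfect_coloring_def)
qed

text \<open>The vertical edge at a vertex of the hexagonal grid points up or down according to the
  parity of the coordinate sum, which a translation by such a vector keeps.\<close>

lemma grid_adj_translate:
  assumes "even (fst w + snd w)"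
  shows "grid_adj G (u + w) (v + w) \<longleftrightarrow> grid_adj G u v"
proof -
  obtain a b x y p q where [simp]: "u = (a, b)" "v = (x, y)" "w = (p, q)"
    by (metis surj_pair)
  have shift: "x + p = a + p + e \<longleftrightarrow> x = a + e" "x + p = a + p - e \<longleftrightarrow> x = a - e"
    "y + q = b + q + e \<longleftrightarrow> y = b + e" "y + q = b + q - e \<longleftrightarrow> y = b - e" for e
    by linarith+
  have "even (a + p + (b + q)) \<longleftrightarrow> even (a + b)"
    using assms by auto
  then show ?thesis
    using shift[of 1] by (cases G) simp_all
qed

lemma lin_indep_pair_det_nonzero:
  assumes "lin_indep_pair (a, b) (c, d)"
  shows "a * d - b * c \<noteq> 0"
proof
  assume "a * d - b * c = 0"
  then have det: "real_of_int a * real_of_int d = real_of_int b * real_of_int c"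
    by (metis eq_iff_diff_eq_0 of_int_mult)
  let ?v = "real_vec (a, b)" and ?w = "real_vec (c, d)"
  have indep: "independent {?v, ?w}" and "?v \<noteq> ?w"
    using assms by (auto simp: lin_indep_pair_def real_vec_def)
  have "?w \<noteq> 0"
    using indep dependent_zero[of "{?v, ?w}"] by auto
  then consider "d \<noteq> 0" | "d = 0" "c \<noteq> 0"
    by (auto simp: real_vec_def zero_prod_def)
  then obtain s where "?v = s *\<^sub>R ?w"
  proof cases
    case 1
    then have "?v = (b / d) *\<^sub>R ?w"
      using det by (auto simp: real_vec_def field_simps)
    then show ?thesis by (rule that)
  next
    case 2
    then have "?v = (a / c) *\<^sub>R ?w"
      using det by (auto simp: real_vec_def field_simps)
    then show ?thesis by (rule that)
  qed
  then have "?v \<in> span {?w}"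
    by (simp add: span_base span_scale)
  then show False
    using indep \<open>?v \<noteq> ?w\<close> by (simp add: independent_insert)
qed

lemma period_int_multiple:
  fixes f :: "int \<times> int \<Rightarrow> 'c"
  assumes "\<And>i. f (i + (a, b)) = f i"
  shows "f (i + (s * a, s * b)) = f i"
proof (induction s rule: int_induct[where k = 0])
  case base
  then show ?case by (simp flip: zero_prod_def)
next
  case (step1 s)
  then show ?case
    using assms[of "i + (s * a, s * b)"] by (simp add: algebra_simps)
next
  case (step2 s)
  then show ?case
    using assms[of "i + ((s - 1) * a, (s - 1) * b)"] by (simp add: algebra_simps)
qed

text \<open>Cramer's rule: for \<open>v1 = (a, b)\<close> and \<open>v2 = (c, d)\<close> one has
  \<open>d * v1 - b * v2 = (D, 0)\<close> and \<open>a * v2 - c * v1 = (0, D)\<close>. Doubling \<open>D\<close> makes the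
  modulus even for all three grids at once.\<close>

lemma periodic_axis_period:
  assumes "periodic_coloring G \<Gamma>"
  shows "\<exists>N>0. even N \<and> (\<forall>i. \<Gamma> (i + (N, 0)) = \<Gamma> i \<and> \<Gamma> (i + (0, N)) = \<Gamma> i)"
proof -
  obtain a b c d where indep: "lin_indep_pair (a, b) (c, d)"
    and per: "\<And>i. \<Gamma> (i + (a, b)) = \<Gamma> i" "\<And>i. \<Gamma> (i + (c, d)) = \<Gamma> i"
    using assms unfolding periodic_coloring_def by (metis surj_pair)
  define D where "D = a * d - b * c"
  have "D \<noteq> 0"
    using lin_indep_pair_det_nonzero[OF indep] by (simp add: D_def)
  have comb: "\<Gamma> (i + (s * a + t * c, s * b + t * d)) = \<Gamma> i" for i s t
  proof -
    have "i + (s * a + t * c, s * b + t * d) = i + (t * c, t * d) + (s * a, s * b)"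
      by (cases i) simp
    then show ?thesis
      using period_int_multiple[of \<Gamma> a b] period_int_multiple[of \<Gamma> c d] per by metis
  qed
  have mults: "\<Gamma> (i + (s * D, 0)) = \<Gamma> i" "\<Gamma> (i + (0, s * D)) = \<Gamma> i" for i s
    using comb[of i "s * d" "- s * b"] comb[of i "- s * c" "s * a"]
    by (simp_all add: D_def algebra_simps)
  define N where "N = 2 * \<bar>D\<bar>"
  have "N = (2 * sgn D) * D"
    by (simp add: N_def abs_sgn)
  then have "\<Gamma> (i + (N, 0)) = \<Gamma> i" "\<Gamma> (i + (0, N)) = \<Gamma> i" for i
    by (simp_all only: mults)
  moreover have "N > 0" "even N"
    using \<open>D \<noteq> 0\<close> by (simp_all add: N_def)
  ultimately show ?thesis
    by blast
qed

lemma period_imp_eq_mod: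
  fixes \<Gamma> :: "int \<times> int \<Rightarrow> 'c"
  assumes "\<And>i. \<Gamma> (i + (N, 0)) = \<Gamma> i" "\<And>i. \<Gamma> (i + (0, N)) = \<Gamma> i"
  shows "\<Gamma> (x, y) = \<Gamma> (x mod N, y mod N)"
  using period_int_multiple[of \<Gamma> N 0 "(x mod N, y mod N)" "x div N"]
    period_int_multiple[of \<Gamma> 0 N "(x, y mod N)" "y div N"] assms by simp

theorem theorem4p8:
  fixes G :: grid and \<Gamma>' :: "vertex \<Rightarrow> 'c" and C' :: "'c set"
  assumes "finite C'" and "\<Gamma>' \<in> UNIV \<rightarrow> C'" and "periodic_coloring G \<Gamma>'"
  shows "\<exists>(n::nat) (\<Gamma> :: vertex \<Rightarrow> nat).
           perfect_coloring (grid_adj G) (grid_degree G) n \<Gamma> \<and>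
           (\<forall>i j. \<Gamma>' i \<noteq> \<Gamma>' j \<longrightarrow> \<Gamma> i \<noteq> \<Gamma> j)"
proof -
  obtain N where N: "N > 0" "even N"
    "\<And>i. \<Gamma>' (i + (N, 0)) = \<Gamma>' i" "\<And>i. \<Gamma>' (i + (0, N)) = \<Gamma>' i"
    using periodic_axis_period[OF assms(3)] by blast
  define f where "f i = (fst i mod N, snd i mod N)" for i :: vertex
  have refines: "\<Gamma>' i = \<Gamma>' (f i)" for i
    using period_imp_eq_mod[of \<Gamma>' N "fst i" "snd i"] N by (simp add: f_def)
  have "range f \<subseteq> {0..<N} \<times> {0..<N}"
    using N by (auto simp: f_def)
  then have fin: "finite (range f)"
    by (rule finite_subset) simp
  have trans: "\<exists>T. bij T \<and> (\<forall>u v. grid_adj G (T u) (T v) \<longleftrightarrow> grid_adj G u v)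
      \<and> (\<forall>u. f (T u) = f u) \<and> T i = j" if "f i = f j" for i j
  proof -
    define w where "w = j - i"
    have "N dvd fst w" "N dvd snd w"
      using that by (auto simp: f_def w_def mod_eq_dvd_iff dvd_diff_commute)
    then have "even (fst w + snd w)" and "f (u + w) = f u" for u
      using N(2) by (auto simp: f_def mod_eq_dvd_iff intro: dvd_trans)
    moreover have "bij (\<lambda>u. u + w)"
      by (rule bij_betw_byWitness[where f' = "\<lambda>u. u - w"]) auto
    ultimately show ?thesis
      by (intro exI[of _ "\<lambda>u. u + w"]) (simp add: grid_adj_translate w_def)
  qed
  have "\<exists>n \<Gamma>. perfect_coloring (grid_adj G) (grid_degree G) n \<Gamma> \<and>
      (\<forall>i j. f i \<noteq> f j \<longrightarrow> \<Gamma> i \<noteq> \<Gamma> j)"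
    by (rule transitive_classes_imp_perfect[OF grid_regular fin]) (rule trans)
  then show ?thesis
    using refines by metis
qed

end
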